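(* Let $\ell\in\mathbb N$. There exists an acute lattice triangle of lattice perimeter $\ell$ whose centroid is a lattice point if and only if $\ell\ge 3$ and $\ell\notin\{5,11\}$.
   Context: $\mathbb N$ denotes the positive integers. A lattice point is an element of $\mathbb Z^2\subseteq\mathbb R^2$. A lattice triangle is a (nondegenerate) triangle in $\mathbb R^2$ whose three vertices are lattice points. The lattice length of a segment joining two lattice points is the number of lattice points on the segment (endpoints included) minus one. The lattice perimeter of a lattice triangle is the sum of the lattice lengths of its three sides. A triangle is acute if all its interior angles are strictly less than $\pi/2$. *)

theory Defs
  imports "HOL-Analysis.Analysis"
begin

definition lattice_points :: "(real^2) set" where
  "lattice_points = {x. \<forall>i. x $ i \<in> \<int>}"

text \<open>The truncated subtraction on natural numbers is harmless for lattice points \<open>a\<close> and \<open>b\<close>: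
  the set below is then finite and contains \<open>a\<close>.\<close>

definition lattice_length :: "real^2 \<Rightarrow> real^2 \<Rightarrow> nat" where
  "lattice_length a b = card (closed_segment a b \<inter> lattice_points) - 1"

text \<open>Triangles are represented by their three vertices.\<close>

definition lattice_triangle :: "real^2 \<Rightarrow> real^2 \<Rightarrow> real^2 \<Rightarrow> bool" where
  "lattice_triangle a b c \<longleftrightarrow>
     a \<in> lattice_points \<and> b \<in> lattice_points \<and> c \<in> lattice_points \<and> \<not> collinear {a, b, c}"

definition lattice_perimeter :: "real^2 \<Rightarrow> real^2 \<Rightarrow> real^2 \<Rightarrow> nat" where
  "lattice_perimeter a b c = lattice_length a b + lattice_length b c + lattice_length c a"

text \<open>\<open>angle a b c\<close> is the unoriented angle at the vertex \<open>b\<close>, a number between \<open>0\<close> and \<open>pi\<close>.\<close>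

definition angle :: "real^2 \<Rightarrow> real^2 \<Rightarrow> real^2 \<Rightarrow> real" where
  "angle a b c = arccos ((a - b) \<bullet> (c - b) / (norm (a - b) * norm (c - b)))"

definition acute_triangle :: "real^2 \<Rightarrow> real^2 \<Rightarrow> real^2 \<Rightarrow> bool" where
  "acute_triangle a b c \<longleftrightarrow> angle c a b < pi / 2 \<and> angle a b c < pi / 2 \<and> angle b c a < pi / 2"

definition centroid :: "real^2 \<Rightarrow> real^2 \<Rightarrow> real^2 \<Rightarrow> real^2" where
  "centroid a b c = (1 / 3) *\<^sub>R (a + b + c)"

end

theory Submission
  imports Defs
begin

text \<open>Let \<open>u\<close>, \<open>v\<close> and \<open>- (u + v)\<close> be the edge vectors of a lattice triangle. The centroid is a
  lattice point iff \<open>u \<equiv> v (mod 3)\<close>, in which case all three edges are congruent modulo 3; so 3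
  divides all or none of the lattice lengths, and any common divisor of two of them divides the
  third. These conditions alone leave no triple of lengths with sum 5 or 11.

  For the converse, scaling a triangle by \<open>k\<close> multiplies its perimeter by \<open>k\<close>, and three families
  suffice. The lengths \<open>1, 1, n\<close> with \<open>n \<equiv> 2 (mod 3)\<close> are realised by a triangle with base \<open>n\<close> and
  large height. If \<open>a\<close> and \<open>b\<close> are coprime and \<open>a \<equiv> b \<equiv> \<plusminus>1 (mod 3)\<close>, the edges \<open>a (1, 2)\<close> and
  \<open>b (-11, 5)\<close> leave a third edge of length 1: that length divides the determinant 27 of the two
  directions but is prime to 3. The directions are nearly perpendicular and short against
  their determinant, so the triangle is acute as long as \<open>a\<close> and \<open>b\<close> are not too far apart.\<close>

section \<open>Integer vectors and lattice lengths as gcds\<close>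

definition ivec :: "int \<Rightarrow> int \<Rightarrow> real^2" where
  "ivec x y = vector [of_int x, of_int y]"

lemma ivec_nth [simp]: "ivec x y $ 1 = of_int x" "ivec x y $ 2 = of_int y"
  by (simp_all add: ivec_def)

lemma ivec_add: "ivec x y + ivec x' y' = ivec (x + x') (y + y')"
  by (simp add: vec_eq_iff forall_2)

lemma ivec_diff: "ivec x y - ivec x' y' = ivec (x - x') (y - y')"
  by (simp add: vec_eq_iff forall_2)

lemma ivec_eq_iff [simp]: "ivec x y = ivec x' y' \<longleftrightarrow> x = x' \<and> y = y'"
  by (simp add: vec_eq_iff forall_2)

lemma inner_ivec: "ivec x y \<bullet> ivec x' y' = of_int (x * x' + y * y')"
  by (simp add: inner_vec_def sum_2)

lemma ivec_in_lattice_points [simp]: "ivec x y \<in> lattice_points"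
  by (simp add: lattice_points_def forall_2)

lemma lattice_pointsE:
  assumes "p \<in> lattice_points"
  obtains x y where "p = ivec x y"
proof -
  from assms obtain x y where "p $ 1 = of_int x" "p $ 2 = of_int y"
    by (auto simp: lattice_points_def forall_2 elim!: Ints_cases)
  then have "p = ivec x y" by (simp add: vec_eq_iff forall_2)
  then show ?thesis by (rule that)
qed

text \<open>Dividing the edge vector by \<open>g\<close> leaves a primitive vector, and the lattice
  points are the integer steps along it.\<close>

lemma closed_segment_Int_lattice_points:
  fixes x y x' y' :: int
  defines "g \<equiv> gcd (x' - x) (y' - y)"
  assumes g: "g \<noteq> 0"
  shows "closed_segment (ivec x y) (ivec x' y') \<inter> lattice_points =
    (\<lambda>k. ivec (x + k * ((x' - x) div g)) (y + k * ((y' - y) div g))) ` {0..g}"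
    (is "_ = ?f ` _")
proof -
  define dx where "dx = (x' - x) div g"
  define dy where "dy = (y' - y) div g"
  have x': "x' = x + g * dx" and y': "y' = y + g * dy"
    by (simp_all add: dx_def dy_def g_def)
  have "g > 0" using g by (simp add: g_def order_less_le)
  have "p \<in> ?f ` {0..g}"
    if "p \<in> closed_segment (ivec x y) (ivec x' y')" "p \<in> lattice_points" for p
  proof -
    from that obtain t i j where t: "0 \<le> t" "t \<le> 1"
      "ivec i j = (1 - t) *\<^sub>R ivec x y + t *\<^sub>R ivec x' y'" and p: "p = ivec i j"
      by (auto simp: in_segment elim!: lattice_pointsE)
    have i: "of_int i = of_int x + t * of_int g * of_int dx"
      and j: "of_int j = of_int y + t * of_int g * of_int dy"
      using t(3) by (simp_all add: vec_eq_iff forall_2 x' y' algebra_simps)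
    \<comment> \<open>By Bezout, an integer combination of \<open>dx\<close> and \<open>dy\<close>
      equals 1. The same combination of the offsets \<open>i - x\<close> and \<open>j - y\<close>
      equals \<open>t * g\<close>, which is therefore an integer.\<close>
    obtain r s where "r * (x' - x) + s * (y' - y) = g"
      using bezout_int unfolding g_def by blast
    then have "g * (r * dx + s * dy) = g * 1" by (simp add: x' y' algebra_simps)
    then have rs: "r * dx + s * dy = 1" using g by (metis mult_cancel_left)
    define k where "k = r * (i - x) + s * (j - y)"
    have "real_of_int k = t * of_int g * of_int (r * dx + s * dy)"
      by (simp add: k_def i j algebra_simps)
    then have k: "real_of_int k = t * of_int g" by (simp add: rs)
    have "0 \<le> real_of_int k" "real_of_int k \<le> of_int g"
      using t \<open>g > 0\<close> by (simp_all add: k mult_left_le_one_le)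
    moreover have "real_of_int i = of_int (x + k * dx)" "real_of_int j = of_int (y + k * dy)"
      by (simp_all add: i j k)
    ultimately show ?thesis
      unfolding p dx_def dy_def by (intro image_eqI[of _ _ k]) (simp_all only: of_int_eq_iff, simp_all)
  qed
  moreover have "?f k \<in> closed_segment (ivec x y) (ivec x' y')" if "k \<in> {0..g}" for k
    unfolding in_segment
  proof (intro exI conjI)
    show "0 \<le> of_int k / real_of_int g" "of_int k / real_of_int g \<le> 1"
      using that \<open>g > 0\<close> by simp_all
    show "?f k = (1 - of_int k / of_int g) *\<^sub>R ivec x y + (of_int k / of_int g) *\<^sub>R ivec x' y'"
      using \<open>g > 0\<close> unfolding dx_def[symmetric] dy_def[symmetric]
      by (simp add: vec_eq_iff forall_2 x' y' field_simps)
  qed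
  ultimately show ?thesis by auto
qed

lemma lattice_length_ivec:
  "int (lattice_length (ivec x y) (ivec x' y')) = gcd (x' - x) (y' - y)"
proof (cases "gcd (x' - x) (y' - y) = 0")
  case True
  \<comment> \<open>A degenerate segment has a single lattice point, so its length is 0, in
    agreement with \<open>gcd 0 0 = 0\<close>.\<close>
  then have "x' = x" "y' = y" by simp_all
  then show ?thesis by (simp add: lattice_length_def)
next
  case False
  define g where "g = gcd (x' - x) (y' - y)"
  have "inj_on (\<lambda>k. ivec (x + k * ((x' - x) div g)) (y + k * ((y' - y) div g))) {0..g}"
    using False by (auto simp: inj_on_def g_def dvd_div_eq_0_iff)
  then have "card (closed_segment (ivec x y) (ivec x' y') \<inter> lattice_points) = card {0..g}"
    using closed_segment_Int_lattice_points[of x' x y' y] False by (simp add: g_def card_image)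
  then show ?thesis by (simp add: lattice_length_def g_def nat_add_distrib)
qed

section \<open>Acute triangles from integer edge vectors\<close>

lemma angle_less_pi_half:
  assumes "(a - b) \<bullet> (c - b) > 0"
  shows "angle a b c < pi / 2"
proof -
  let ?q = "(a - b) \<bullet> (c - b) / (norm (a - b) * norm (c - b))"
  have "norm (a - b) * norm (c - b) > 0" using assms by (auto simp: zero_less_mult_iff)
  \<comment> \<open>Cauchy-Schwarz keeps \<open>?q\<close> in the interval on which
    \<open>arccos\<close> is strictly decreasing.\<close>
  then have "0 < ?q" "?q \<le> 1"
    using assms norm_cauchy_schwarz[of "a - b" "c - b"] by simp_all
  then have "arccos ?q < arccos 0" by (intro arccos_less_arccos) auto
  then show ?thesis by (simp add: angle_def)
qed

text \<open>If \<open>u + v = c *\<^sub>R u\<close>, the first two inequalities force 0 < c < 1,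
  while the third forces (c - 1) c > 0.\<close>

lemma not_collinear_if_acute:
  fixes u v :: "'a::real_inner"
  assumes "u \<bullet> v < 0" "u \<bullet> (u + v) > 0" "v \<bullet> (u + v) > 0"
  shows "\<not> collinear {0, u, u + v}"
proof
  assume "collinear {0, u, u + v}"
  moreover have "u \<noteq> 0" "u + v \<noteq> 0" using assms by auto
  ultimately obtain c where c: "u + v = c *\<^sub>R u" by (auto simp: collinear_lemma)
  then have v: "v = (c - 1) *\<^sub>R u" by (simp add: algebra_simps)
  have "u \<bullet> u > 0" using \<open>u \<noteq> 0\<close> by simp
  with assms have "c - 1 < 0" "c > 0" "(c - 1) * c > 0"
    unfolding c unfolding v inner_scaleR_left inner_scaleR_right
    by (simp_all add: zero_less_mult_iff mult_less_0_iff)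
  then show False by (simp add: zero_less_mult_iff)
qed

text \<open>\<open>(x1, y1)\<close> and \<open>(x2, y2)\<close> are consecutive edge vectors; the third edge is minus their
  sum, so each of the three inequalities makes one interior angle acute.\<close>

definition realisable :: "int \<Rightarrow> bool" where
  "realisable l \<longleftrightarrow> (\<exists>x1 y1 x2 y2.
     x1 * x2 + y1 * y2 < 0 \<and>
     x1 * (x1 + x2) + y1 * (y1 + y2) > 0 \<and>
     x2 * (x1 + x2) + y2 * (y1 + y2) > 0 \<and>
     3 dvd x1 - x2 \<and> 3 dvd y1 - y2 \<and>
     gcd x1 y1 + gcd x2 y2 + gcd (x1 + x2) (y1 + y2) = l)"

text \<open>With edge vectors u, v and one vertex at the origin, the vertices sum to 2 u + v, which
  is congruent to 3 u modulo 3; hence the centroid is integral.\<close>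

lemma realisable_imp_triangle:
  assumes "realisable (int l)"
  shows "\<exists>a b c. lattice_triangle a b c \<and> acute_triangle a b c \<and>
    lattice_perimeter a b c = l \<and> centroid a b c \<in> lattice_points"
proof -
  from assms obtain x1 y1 x2 y2 where
    dot: "x1 * x2 + y1 * y2 < 0" "x1 * (x1 + x2) + y1 * (y1 + y2) > 0"
      "x2 * (x1 + x2) + y2 * (y1 + y2) > 0"
    and cong: "3 dvd x1 - x2" "3 dvd y1 - y2"
    and len: "gcd x1 y1 + gcd x2 y2 + gcd (x1 + x2) (y1 + y2) = int l"
    unfolding realisable_def by blast
  define a where "a = ivec 0 0"
  define b where "b = ivec x1 y1"
  define c where "c = ivec (x1 + x2) (y1 + y2)"
  have a0: "a = 0" by (simp add: a_def vec_eq_iff forall_2)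
  have c_eq: "c = ivec x1 y1 + ivec x2 y2" by (simp add: c_def ivec_add)
  have "\<not> collinear {a, b, c}"
    unfolding a0 b_def c_eq using dot
    by (intro not_collinear_if_acute)
      (simp_all only: ivec_add inner_ivec of_int_less_0_iff of_int_0_less_iff)
  then have "lattice_triangle a b c"
    by (simp add: lattice_triangle_def a_def b_def c_def)
  moreover have "acute_triangle a b c"
    unfolding acute_triangle_def a_def b_def c_def using dot
    by (intro conjI angle_less_pi_half)
      (simp_all only: ivec_diff inner_ivec of_int_0_less_iff, simp_all add: algebra_simps)
  moreover have "int (lattice_perimeter a b c) = int l"
    unfolding lattice_perimeter_def of_nat_add a_def b_def c_def lattice_length_ivec
    using len by (simp add: gcd_neg1_int gcd_neg2_int minus_add_distrib[symmetric]
      del: minus_add_distrib add_uminus_conv_diff)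
  moreover have "centroid a b c \<in> lattice_points"
  proof -
    from cong obtain i j where "x1 - x2 = 3 * i" "y1 - y2 = 3 * j" by (auto elim!: dvdE)
    then have "x2 = x1 - 3 * i" "y2 = y1 - 3 * j" by simp_all
    then have "centroid a b c = ivec (x1 - i) (y1 - j)"
      by (simp add: centroid_def a_def b_def c_def vec_eq_iff forall_2)
    then show ?thesis by simp
  qed
  ultimately show ?thesis by (metis of_nat_eq_iff)
qed

lemma realisable_mult:
  assumes "realisable l" "k > 0"
  shows "realisable (k * l)"
proof -
  from assms obtain x1 y1 x2 y2 where
    *: "x1 * x2 + y1 * y2 < 0" "x1 * (x1 + x2) + y1 * (y1 + y2) > 0"
      "x2 * (x1 + x2) + y2 * (y1 + y2) > 0" "3 dvd x1 - x2" "3 dvd y1 - y2"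
      "gcd x1 y1 + gcd x2 y2 + gcd (x1 + x2) (y1 + y2) = l"
    unfolding realisable_def by blast
  have dot: "(k * x) * (k * x') + (k * y) * (k * y') = k\<^sup>2 * (x * x' + y * y')" for x y x' y'
    by (simp add: power2_eq_square algebra_simps)
  have gcd: "gcd (k * x) (k * y) = k * gcd x y" for x y
    using \<open>k > 0\<close> gcd_mult_distrib_int[of k x y] by simp
  show ?thesis
    unfolding realisable_def
    by (rule exI[of _ "k * x1"], rule exI[of _ "k * y1"],
        rule exI[of _ "k * x2"], rule exI[of _ "k * y2"],
        unfold distrib_left[symmetric] right_diff_distrib[symmetric] dot gcd)
      (use * \<open>k > 0\<close> in \<open>auto simp: mult_less_0_iff zero_less_mult_iff intro!: dvd_mult\<close>)
qed

section \<open>Constructions of realisable perimeters\<close>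

lemma realisable_one_one:
  assumes "n mod 3 = 2" "n > 0"
  shows "realisable (n + 2)"
proof -
  have "n \<ge> 2" using assms by presburger
  have "coprime (n - 1) n" by (simp add: coprime_diff_one_left)
  moreover have "coprime (n - 1) 3"
    using assms(1) by (subst coprime_commute, intro prime_imp_coprime) (simp_all, presburger)
  ultimately have "coprime (n - 1) (3 * n)" by simp
  then have "gcd (1 - n) (3 * n) = 1"
    by (metis coprime_iff_gcd_eq_1 gcd_neg1_int minus_diff_eq)
  then have gcd: "gcd (1 - n) (- (3 * n)) = 1" by simp
  show ?thesis
    unfolding realisable_def
  \<comment> \<open>The apex is the origin and the base runs from 1 - n to 1 at height -3 n, so the
    altitude meets the base in its interior. The edges agree modulo 3 because 2 n is 1 modulo
    3.\<close>
  proof (rule exI[of _ "1 - n"], rule exI[of _ "- (3 * n)"], rule exI[of _ n], rule exI[of _ 0],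
      intro conjI)
    show "(1 - n) * n + - (3 * n) * 0 < 0" using \<open>n \<ge> 2\<close> by (simp add: mult_less_0_iff)
    have "n * 1 \<le> n * (9 * n)" using \<open>n \<ge> 2\<close> by (intro mult_left_mono) auto
    then show "(1 - n) * (1 - n + n) + - (3 * n) * (- (3 * n) + 0) > 0"
      by (simp add: algebra_simps)
    show "n * (1 - n + n) + 0 * (- (3 * n) + 0) > 0" using \<open>n \<ge> 2\<close> by simp
    show "3 dvd 1 - n - n" "3 dvd - (3 * n) - 0" using assms(1) by presburger+
    show "gcd (1 - n) (- (3 * n)) + gcd n 0 + gcd (1 - n + n) (- (3 * n) + 0) = n + 2"
      using gcd \<open>n \<ge> 2\<close> by simp
  qed
qed

text \<open>The directions (1, 2) and (-11, 5) agree modulo 3, so \<open>a\<close> and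
  \<open>b\<close> congruent modulo 3 make the edges congruent. Their squared lengths are 5 and 146
  and their inner product is -1, so two of the angle conditions become b < 5 a and a < 146
  b.\<close>

lemma realisable_one_coprime:
  assumes "coprime a b" "a > 0" "b > 0" "b < 5 * a" "a < 5 * b"
    and mod: "a mod 3 = b mod 3" "a mod 3 \<noteq> 0"
  shows "realisable (1 + a + b)"
proof -
  define g where "g = gcd (a - 11 * b) (2 * a + 5 * b)"
  have g: "g dvd a - 11 * b" "g dvd 2 * a + 5 * b" by (simp_all add: g_def)
  \<comment> \<open>Eliminating first \<open>a\<close>, then \<open>b\<close>, from the coordinates
    of the third edge leaves multiples of the determinant 27.\<close>
  have "g dvd (2 * a + 5 * b) - 2 * (a - 11 * b)" by (rule dvd_diff[OF g(2) dvd_mult[OF g(1)]])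
  then have "g dvd 27 * b" by (simp add: mult.commute)
  have "g dvd 5 * (a - 11 * b) + 11 * (2 * a + 5 * b)" by (rule dvd_add[OF g(1)[THEN dvd_mult] g(2)[THEN dvd_mult]])
  then have "g dvd 27 * a" by simp
  with \<open>g dvd 27 * b\<close> have "g dvd gcd (27 * a) (27 * b)" by simp
  also have "gcd (27 * a) (27 * b) = 27" using assms(1) gcd_mult_distrib_int[of 27 a b] by simp
  finally have "g dvd 3 ^ 3" by simp
  moreover have "\<not> 3 dvd g"
  proof
    assume "3 dvd g"
    then have "3 dvd a - 11 * b" using g(1) by (rule dvd_trans)
    \<comment> \<open>Modulo 3 this coordinate is a + b, that is 2 a, which is nonzero.\<close>
    then have "3 dvd a - 11 * b + 3 * (4 * b)" by (rule dvd_add) (rule dvd_triv_left)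
    then have "3 dvd a + b" by (simp add: add.commute)
    then show False using mod by presburger
  qed
  then have "coprime (3 ^ 3) g" by (intro coprime_power_left_iff[THEN iffD2] disjI1 prime_imp_coprime) simp_all
  ultimately have "g dvd 1" by (metis coprime_common_divisor dvd_refl)
  then have g1: "g = 1" by (simp add: g_def)
  have gcd1: "gcd a (2 * a) = a" using \<open>a > 0\<close> by simp
  have "gcd (b * - 11) (b * 5) = b * gcd (- 11) 5"
    using \<open>b > 0\<close> gcd_mult_distrib_int[of b "- 11" 5] by simp
  also have "gcd (- 11) 5 = (1 :: int)" by (simp add: gcd_red_int[of 11 5])
  finally have gcd2: "gcd (- (11 * b)) (5 * b) = b" by (simp add: mult.commute)
  show ?thesis
    unfolding realisable_def
  proof (rule exI[of _ a], rule exI[of _ "2 * a"], rule exI[of _ "- (11 * b)"],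
      rule exI[of _ "5 * b"], intro conjI)
    show "a * - (11 * b) + 2 * a * (5 * b) < 0"
      using assms by (simp add: algebra_simps)
    have "a * (5 * a - b) > 0" using assms by simp
    then show "a * (a + - (11 * b)) + 2 * a * (2 * a + 5 * b) > 0" by (simp add: algebra_simps)
    have "b * (146 * b - a) > 0" using assms by simp
    then show "- (11 * b) * (a + - (11 * b)) + 5 * b * (2 * a + 5 * b) > 0"
      by (simp add: algebra_simps)
    from mod(1) obtain k where "a - b = 3 * k" by (auto simp: mod_eq_dvd_iff elim!: dvdE)
    then have "a - - (11 * b) = 3 * (k + 4 * b)" "2 * a - 5 * b = 3 * (2 * k - b)" by simp_all
    then show "3 dvd a - - (11 * b)" "3 dvd 2 * a - 5 * b" by simp_all
    show "gcd a (2 * a) + gcd (- (11 * b)) (5 * b) + gcd (a + - (11 * b)) (2 * a + 5 * b) = 1 + a + b"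
      using g1 unfolding gcd1 gcd2 by (simp add: g_def)
  qed
qed

text \<open>Here l - 1 = 2 m is split as (m - d) + (m + d). As 3 divides \<open>d\<close>, both
  parts are 2 modulo 3; as \<open>d\<close> and \<open>m\<close> have opposite parity, both are odd.
  A common divisor divides 2 d, hence 12, but is prime to 2 and 3.\<close>

lemma realisable_5_mod_6:
  assumes "l mod 6 = 5" "l \<ge> 17"
  shows "realisable l"
proof -
  define m where "m = l div 2"
  have l: "l = 2 * m + 1" and m3: "m mod 3 = 2" and "m \<ge> 8"
    using assms unfolding m_def by presburger+
  define d :: int where "d = (if even m then 3 else 6)"
  \<comment> \<open>Equality holds at the least even and odd values, m = 8 and m = 11. With
    \<open>d \<le> 6\<close> this gives m + d < 5 (m - d).\<close>
  have "m \<ge> d + 5" using \<open>m \<ge> 8\<close> m3 unfolding d_def by presburger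
  have "0 < d" "d \<le> 6" "3 dvd d" by (simp_all add: d_def)
  define g where "g = gcd (m - d) (m + d)"
  have g: "g dvd m - d" "g dvd m + d" by (simp_all add: g_def)
  from g(2,1) have "g dvd (m + d) - (m - d)" by (rule dvd_diff)
  also have "(m + d) - (m - d) = 2 * d" by simp
  also have "2 * d dvd 12" by (simp add: d_def)
  finally have "g dvd 12" .
  have "odd (m - d)" by (simp add: d_def)
  with g(1) have "odd g" using dvd_trans by blast
  moreover have "\<not> 3 dvd m - d" using m3 \<open>3 dvd d\<close> by presburger
  with g(1) have "\<not> 3 dvd g" using dvd_trans by blast
  ultimately have "coprime 2 g" "coprime 3 g" by (simp_all add: prime_imp_coprime)
  then have "coprime (2 * (2 * 3)) g" unfolding coprime_mult_left_iff by blast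
  then have "coprime 12 g" by simp
  then have "is_unit g" using \<open>g dvd 12\<close> by (auto intro: coprime_common_divisor)
  then have "coprime (m - d) (m + d)" by (simp add: g_def coprime_iff_gcd_eq_1)
  then have "realisable (1 + (m - d) + (m + d))"
  proof (rule realisable_one_coprime)
    show "(m - d) mod 3 = (m + d) mod 3" "(m - d) mod 3 \<noteq> 0"
      using m3 \<open>3 dvd d\<close> by presburger+
  qed (use \<open>m \<ge> d + 5\<close> \<open>0 < d\<close> \<open>d \<le> 6\<close> in simp_all)
  then show ?thesis by (simp add: l)
qed

text \<open>Multiples of 3 are scaled from lengths 1, 1, 1, and residue 1 modulo 3 uses lengths 1,
  1, n. Even numbers of residue 2 are twice a number of residue 1; of the odd ones only 5 and 11 lie
  below 17.\<close>

lemma realisable_if: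
  assumes "l \<ge> 3" "l \<noteq> 5" "l \<noteq> 11"
  shows "realisable l"
proof -
  have mod1: "realisable k" if "k mod 3 = 1" "k \<ge> 4" for k
  proof -
    from that have "(k - 2) mod 3 = 2" "k - 2 > 0" by presburger+
    then have "realisable (k - 2 + 2)" by (rule realisable_one_one)
    then show ?thesis by simp
  qed
  have "l mod 3 = 0 \<or> l mod 3 = 1 \<or> l mod 6 = 2 \<or> l mod 6 = 5" by presburger
  then consider "l mod 3 = 0" | "l mod 3 = 1" | "l mod 6 = 2" | "l mod 6 = 5" by blast
  then show ?thesis
  proof cases
    case 1
    have "realisable 3" using realisable_one_coprime[of 1 1] by simp
    then have "realisable ((l div 3) * 3)" using assms by (intro realisable_mult) auto
    with 1 show ?thesis by (metis add.right_neutral div_mult_mod_eq)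
  next
    case 2
    with assms show ?thesis by (intro mod1) presburger+
  next
    case 3
    with assms have "realisable (l div 2)" by (intro mod1) presburger+
    then have "realisable (2 * (l div 2))" by (rule realisable_mult) simp
    moreover from 3 have "2 * (l div 2) = l" by presburger
    ultimately show ?thesis by simp
  next
    case 4
    with assms show ?thesis by (intro realisable_5_mod_6) presburger+
  qed
qed

section \<open>Necessity: excluding the perimeters 5 and 11\<close>

text \<open>As 3 divides neither 5 nor 11, no length is a multiple of 3. Up to order this leaves
  1+2+2 for 5, and 2+2+7, 2+4+5, 1+2+8, 1+5+5 for 11; in each, two lengths share a factor that the
  third lacks.\<close>

lemma perimeter_arith:
  fixes g1 g2 g3 :: nat
  assumes pos: "g1 > 0" "g2 > 0" "g3 > 0"
    and three: "3 dvd g1 \<longleftrightarrow> 3 dvd g2" "3 dvd g2 \<longleftrightarrow> 3 dvd g3"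
    and gcd: "gcd g1 g2 dvd g3" "gcd g2 g3 dvd g1" "gcd g3 g1 dvd g2"
  shows "g1 + g2 + g3 \<ge> 3 \<and> g1 + g2 + g3 \<notin> {5, 11}"
proof -
  have "g1 + g2 + g3 \<noteq> l" if "l = 5 \<or> l = 11" for l
  proof
    assume sum: "g1 + g2 + g3 = l"
    then have g3: "g3 = l - g1 - g2" by simp
    have "g1 \<in> {1, 2, 3, 4, 5, 6, 7, 8, 9}" "g2 \<in> {1, 2, 3, 4, 5, 6, 7, 8, 9}"
      using sum pos that unfolding insert_iff empty_iff by arith+
    with pos(3) three gcd that show False
      unfolding g3 by (elim insertE emptyE disjE) simp_all
  qed
  then show ?thesis using pos by auto
qed

lemma triangle_perimeter:
  assumes "lattice_triangle a b c" "centroid a b c \<in> lattice_points"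
  shows "lattice_perimeter a b c \<ge> 3 \<and> lattice_perimeter a b c \<notin> {5, 11}"
proof -
  from assms(1) have lat: "a \<in> lattice_points" "b \<in> lattice_points" "c \<in> lattice_points"
    and ncol: "\<not> collinear {a, b, c}" by (simp_all add: lattice_triangle_def)
  obtain x1 y1 where a: "a = ivec x1 y1" using lat(1) by (rule lattice_pointsE)
  obtain x2 y2 where b: "b = ivec x2 y2" using lat(2) by (rule lattice_pointsE)
  obtain x3 y3 where c: "c = ivec x3 y3" using lat(3) by (rule lattice_pointsE)
  obtain i j where "centroid a b c = ivec i j" using assms(2) by (rule lattice_pointsE)
  then have "real_of_int (x1 + x2 + x3) = of_int (3 * i)" "real_of_int (y1 + y2 + y3) = of_int (3 * j)"
    by (simp_all add: centroid_def a b c vec_eq_iff forall_2 field_simps)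
  then have cong: "x1 + x2 + x3 = 3 * i" "y1 + y2 + y3 = 3 * j" by (simp_all only: of_int_eq_iff)
  \<comment> \<open>Applied to each coordinate, this shows that consecutive edges agree in
    divisibility by 3.\<close>
  have three: "3 dvd s - r \<longleftrightarrow> 3 dvd t - s" if "r + s + t = 3 * k" for r s t k :: int
  proof -
    have "t - s = (s - r) + 3 * (k - s)" using that by simp
    then show ?thesis by (simp only: dvd_add_left_iff dvd_triv_left)
  qed
  have distinct: "a \<noteq> b" "b \<noteq> c" "c \<noteq> a" using ncol by (auto simp: insert_commute)
  have dvd_length: "k dvd lattice_length (ivec x y) (ivec x' y') \<longleftrightarrow>
      int k dvd x' - x \<and> int k dvd y' - y" for k x y x' y'
    unfolding int_dvd_int_iff[symmetric] lattice_length_ivec by simp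
  \<comment> \<open>The edge vectors sum to zero, so a common divisor of two of them divides the
    third.\<close>
  have dvd_third: "gcd (lattice_length (ivec x y) (ivec x' y'))
      (lattice_length (ivec x' y') (ivec x'' y'')) dvd lattice_length (ivec x'' y'') (ivec x y)"
    (is "?k dvd _") for x y x' y' x'' y''
  proof -
    have "?k dvd lattice_length (ivec x y) (ivec x' y')"
      "?k dvd lattice_length (ivec x' y') (ivec x'' y'')" by simp_all
    then have "int ?k dvd x' - x" "int ?k dvd y' - y" "int ?k dvd x'' - x'" "int ?k dvd y'' - y'"
      unfolding dvd_length by blast+
    then have "int ?k dvd (x'' - x') + (x' - x)" "int ?k dvd (y'' - y') + (y' - y)"
      by (simp_all only: dvd_add)
    then show ?thesis unfolding dvd_length by (simp add: dvd_diff_commute)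
  qed
  have length_pos: "lattice_length (ivec x y) (ivec x' y') > 0"
    if "ivec x y \<noteq> ivec x' y'" for x y x' y'
    using that lattice_length_ivec[of x y x' y'] by (intro Nat.gr0I) auto
  show ?thesis
    unfolding lattice_perimeter_def
  proof (rule perimeter_arith)
    show "3 dvd lattice_length a b \<longleftrightarrow> 3 dvd lattice_length b c"
      "3 dvd lattice_length b c \<longleftrightarrow> 3 dvd lattice_length c a"
      using cong three[of x1 x2 x3 i] three[of y1 y2 y3 j] three[of x2 x3 x1 i] three[of y2 y3 y1 j]
      by (simp_all add: a b c dvd_length ac_simps)
  qed (use distinct in \<open>auto simp: a b c intro!: length_pos dvd_third\<close>)
qed

theorem theorem3:
  fixes l :: nat
  assumes "l \<ge> 1"
  shows "(\<exists>a b c :: real^2. lattice_triangle a b c \<and> acute_triangle a b c \<and>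
            lattice_perimeter a b c = l \<and> centroid a b c \<in> lattice_points)
         \<longleftrightarrow> l \<ge> 3 \<and> l \<notin> {5, 11}"
proof
  assume "l \<ge> 3 \<and> l \<notin> {5, 11}"
  then have "realisable (int l)" by (intro realisable_if) auto
  then show "\<exists>a b c :: real^2. lattice_triangle a b c \<and> acute_triangle a b c \<and>
      lattice_perimeter a b c = l \<and> centroid a b c \<in> lattice_points"
    by (rule realisable_imp_triangle)
qed (use triangle_perimeter in blast)

end
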